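(* Let $P=(P,\le_P)$ be a finite poset and let $X$ be an ideal in $(\mathcal{C}(P),\preceq)$. Then either there is a constant $c>0$ such that $|X_n|\le n^c$ for all $n\ge 1$, or $|X_n|\ge F_n$ for all $n\ge 1$, where $F_n$ are the Fibonacci numbers $F_0=F_1=1$, $F_n=F_{n-1}+F_{n-2}$ (so $(F_n)_{n\ge1}=(1,2,3,5,8,13,\dots)$).
   Context: For a finite poset $P=(P,\le_P)$, $\mathcal{C}(P)$ is the set of all pairs $(n,\chi)$ with $n\in\mathbb{N}_0$ and $\chi:\binom{[n]}{2}\to P$. We write $(m,\psi)\preceq(n,\chi)$ iff there is an increasing map $f:[m]\to[n]$ with $\psi(\{i,j\})\le_P\chi(\{f(i),f(j)\})$ for all $1\le i<j\le m$. An ideal is a subset $X\subseteq\mathcal{C}(P)$ such that $K\preceq L\in X$ implies $K\in X$. $X_n=\{(n,\chi)\in X\}$. *)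

theory Defs
  imports Complex_Main "HOL-Library.FuncSet" "HOL-Library.Ramsey" "HOL-Number_Theory.Fib"
begin

text \<open>A finite poset is an explicit carrier \<open>P\<close> (possibly empty, possibly a proper subset of its
  type) with a relation \<open>r\<close> such that \<open>partial_order_on P r\<close>; \<open>(x, y) \<in> r\<close> means \<open>x \<le>\<^sub>P y\<close>.\<close>

type_synonym 'p coloring = "nat \<times> (nat set \<Rightarrow> 'p)"

text \<open>The colourings are extensional functions, so that each map from the pairs of \<open>{1..n}\<close> to \<open>P\<close>
  is represented, and hence counted, exactly once.\<close>

definition colorings :: "'p set \<Rightarrow> 'p coloring set" where
  "colorings P = {(n, \<chi>). \<chi> \<in> nsets {1..n} 2 \<rightarrow>\<^sub>E P}"

definition contained :: "'p rel \<Rightarrow> 'p coloring \<Rightarrow> 'p coloring \<Rightarrow> bool" where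
  "contained r K L \<longleftrightarrow>
     (case (K, L) of ((m, \<psi>), (n, \<chi>)) \<Rightarrow>
       \<exists>f. f \<in> {1..m} \<rightarrow> {1..n} \<and> strict_mono_on {1..m} f \<and>
         (\<forall>i j. 1 \<le> i \<and> i < j \<and> j \<le> m \<longrightarrow> (\<psi> {i, j}, \<chi> {f i, f j}) \<in> r))"

definition coloring_ideal :: "'p set \<Rightarrow> 'p rel \<Rightarrow> 'p coloring set \<Rightarrow> bool" where
  "coloring_ideal P r X \<longleftrightarrow>
     X \<subseteq> colorings P \<and> (\<forall>K\<in>colorings P. \<forall>L\<in>X. contained r K L \<longrightarrow> K \<in> X)"

definition level :: "'p coloring set \<Rightarrow> nat \<Rightarrow> 'p coloring set" where
  "level X n = {K \<in> X. fst K = n}"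

text \<open>Fibonacci numbers indexed so that \<open>F\<^sub>0 = F\<^sub>1 = 1\<close>, whereas the library has \<open>fib 0 = 0\<close>.\<close>

definition shifted_fib :: "nat \<Rightarrow> nat" where
  "shifted_fib n = fib (Suc n)"

lemma shifted_fib_simps:
  "shifted_fib 0 = 1" "shifted_fib (Suc 0) = 1"
  "shifted_fib (Suc (Suc n)) = shifted_fib (Suc n) + shifted_fib n"
  by (simp_all add: shifted_fib_def)

text \<open>With \<open>P\<close> finite, \<open>card\<close> is a genuine count of each level.\<close>

lemma finite_level:
  assumes "finite P" "X \<subseteq> colorings P"
  shows "finite (level X n)"
proof (rule finite_subset)
  show "level X n \<subseteq> {n} \<times> (nsets {1..n} 2 \<rightarrow>\<^sub>E P)"
    using assms(2) by (auto simp: level_def colorings_def)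
  show "finite ({n} \<times> (nsets {1..n} 2 \<rightarrow>\<^sub>E P))"
    using assms(1) by (intro finite_cartesian_product finite_PiE finite_imp_finite_nsets) auto
qed

end

theory Submission
  imports Defs
begin

text \<open>By reflexivity of the order, \<open>X\<close> is closed under taking induced colorings. Call \<open>i\<close> and
  \<open>i + 1\<close> twins if they see every other point in the same color. Runs of twins are
  interchangeable, so if the number of adjacent non-twins is at most \<open>k\<close> throughout \<open>X\<close>, then a
  coloring is given by \<open>k\<close> cut points and a color for each pair of intervals, and the growth is
  polynomial. Otherwise Ramsey's theorem, applied to many pairs of adjacent non-twins together with
  points witnessing the difference, produces one of three homogeneous structures: a point that sees
  long sequences in two colors, a long matching of consecutive pairs, or a matching or half graph
  between two separated sets. In each of them the subsets of \<open>{1..<n}\<close> without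
  consecutive elements, of which there are \<open>F\<^sub>n\<close>, are encoded injectively by induced
  colorings of size \<open>n\<close>.\<close>

subsection \<open>Counting induced colorings\<close>

text \<open>The order of \<open>P\<close> enters the lower bound only through this property;
  afterwards \<open>P\<close> is just a set of colors.\<close>

definition hereditary :: "'p coloring set \<Rightarrow> bool" where
  "hereditary X \<longleftrightarrow>
     (\<forall>N \<chi> n g. (N, \<chi>) \<in> X \<longrightarrow> g \<in> {1..n} \<rightarrow> {1..N} \<longrightarrow> strict_mono_on {1..n} g \<longrightarrow>
        (n, \<lambda>e\<in>nsets {1..n} 2. \<chi> (g ` e)) \<in> X)"

lemma coloring_ideal_hereditary:
  assumes "partial_order_on P r" "coloring_ideal P r X"
  shows "hereditary X"
  unfolding hereditary_def
proof (intro allI impI)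
  fix N \<chi> n and g :: "nat \<Rightarrow> nat"
  assume X: "(N, \<chi>) \<in> X" and g: "g \<in> {1..n} \<rightarrow> {1..N}" and mono: "strict_mono_on {1..n} g"
  have "\<chi> \<in> nsets {1..N} 2 \<rightarrow>\<^sub>E P"
    using X assms(2) by (auto simp: coloring_ideal_def colorings_def)
  moreover have "g ` e \<in> nsets {1..N} 2" if "e \<in> nsets {1..n} 2" for e
    using nsets_image_funcset[OF g strict_mono_on_imp_inj_on[OF mono]] that by blast
  ultimately have val: "\<chi> (g ` e) \<in> P" if "e \<in> nsets {1..n} 2" for e
    using that by blast
  \<comment> \<open>The embedding is \<open>g\<close> itself, with equality of colors. Reflexivity
    is available on \<open>P\<close> only, hence the fact \<open>val\<close>.\<close>
  have "contained r (n, \<lambda>e\<in>nsets {1..n} 2. \<chi> (g ` e)) (N, \<chi>)"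
    unfolding contained_def
  proof (simp only: prod.case, intro exI conjI allI impI)
    show "g \<in> {1..n} \<rightarrow> {1..N}" "strict_mono_on {1..n} g"
      by (rule g mono)+
    fix i j
    assume ij: "1 \<le> i \<and> i < j \<and> j \<le> n"
    then have e: "{i, j} \<in> nsets {1..n} 2"
      by auto
    show "((\<lambda>e\<in>nsets {1..n} 2. \<chi> (g ` e)) {i, j}, \<chi> {g i, g j}) \<in> r"
      using val[OF e] assms(1) by (simp only: restrict_apply' e image_insert image_empty)
        (auto simp: partial_order_on_def preorder_on_def refl_on_def)
  qed
  moreover have "(n, \<lambda>e\<in>nsets {1..n} 2. \<chi> (g ` e)) \<in> colorings P"
    using val by (auto simp: colorings_def)
  ultimately show "(n, \<lambda>e\<in>nsets {1..n} 2. \<chi> (g ` e)) \<in> X"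
    using assms(2) X by (auto simp: coloring_ideal_def)
qed

text \<open>The constructions below list their points by index rather than by position;
  \<open>\<sigma>\<close> turns positions into indices.\<close>

lemma ex_sorting:
  fixes f :: "nat \<Rightarrow> nat"
  assumes "inj_on f {1..n}"
  obtains \<sigma> where "bij_betw \<sigma> {1..n} {1..n}" "strict_mono_on {1..n} (f \<circ> \<sigma>)"
proof -
  have card: "card (f ` {1..n}) = n"
    using assms by (simp add: card_image)
  obtain h where h: "bij_betw h {..<n} (f ` {1..n})" "strict_mono_on {..<n} h"
    using ex_bij_betw_strict_mono_card[of "f ` {1..n}"] card by (metis finite_atLeastAtMost finite_imageI)
  define \<sigma> where "\<sigma> = inv_into {1..n} f \<circ> h \<circ> (\<lambda>i. i - 1)"
  have shift: "bij_betw (\<lambda>i::nat. i - 1) {1..n} {..<n}"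
    by (rule bij_betw_byWitness[of _ Suc]) auto
  have "bij_betw (inv_into {1..n} f) (f ` {1..n}) {1..n}"
    using assms by (simp add: bij_betw_inv_into inj_on_imp_bij_betw)
  then have "bij_betw \<sigma> {1..n} {1..n}"
    unfolding \<sigma>_def using h(1) shift by (meson bij_betw_trans)
  moreover have "f (\<sigma> i) = h (i - 1)" if "i \<in> {1..n}" for i
  proof -
    have "h (i - 1) \<in> f ` {1..n}"
      using h(1) that by (auto simp: bij_betw_def)
    then show ?thesis
      by (simp add: \<sigma>_def f_inv_into_f)
  qed
  then have "strict_mono_on {1..n} (f \<circ> \<sigma>)"
    using strict_mono_onD[OF h(2)] by (intro strict_mono_onI) auto
  ultimately show thesis
    by (rule that)
qed

text \<open>Since all members of the family induce the same order on the index set, the position of the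
  point with index \<open>i\<close> in the induced coloring does not depend on the member.\<close>

lemma card_level_ge_family:
  assumes "hereditary X" "finite (level X n)" "(N, \<chi>) \<in> X"
    and range: "\<And>w i. w \<in> W \<Longrightarrow> i \<in> {1..n} \<Longrightarrow> f w i \<in> {1..N}"
    and inj: "\<And>w. w \<in> W \<Longrightarrow> inj_on (f w) {1..n}"
    and ord: "\<And>w w' i j. w \<in> W \<Longrightarrow> w' \<in> W \<Longrightarrow> i \<in> {1..n} \<Longrightarrow> j \<in> {1..n} \<Longrightarrow>
                f w i < f w j \<Longrightarrow> f w' i < f w' j"
    and sep: "\<And>w w'. w \<in> W \<Longrightarrow> w' \<in> W \<Longrightarrow> w \<noteq> w' \<Longrightarrow>
                \<exists>i\<in>{1..n}. \<exists>j\<in>{1..n}. i \<noteq> j \<and> \<chi> {f w i, f w j} \<noteq> \<chi> {f w' i, f w' j}"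
  shows "card W \<le> card (level X n)"
proof (cases "W = {}")
  case False
  then obtain w0 where w0: "w0 \<in> W"
    by blast
  obtain \<sigma> where \<sigma>: "bij_betw \<sigma> {1..n} {1..n}" "strict_mono_on {1..n} (f w0 \<circ> \<sigma>)"
    using ex_sorting[OF inj[OF w0]] .
  have \<sigma>_mem: "\<sigma> i \<in> {1..n}" if "i \<in> {1..n}" for i
    using \<sigma>(1) that by (auto simp: bij_betw_def)
  define K where "K w = (n, \<lambda>e\<in>nsets {1..n} 2. \<chi> ((f w \<circ> \<sigma>) ` e))" for w
  have "K w \<in> level X n" if w: "w \<in> W" for w
  proof -
    have "f w \<circ> \<sigma> \<in> {1..n} \<rightarrow> {1..N}"
      using range[OF w \<sigma>_mem] by auto
    moreover have "strict_mono_on {1..n} (f w \<circ> \<sigma>)"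
      using \<sigma>(2) ord[OF w0 w \<sigma>_mem \<sigma>_mem] by (auto simp: strict_mono_on_def)
    ultimately have "K w \<in> X"
      unfolding K_def using assms(1,3) unfolding hereditary_def by blast
    then show ?thesis
      by (simp add: level_def K_def)
  qed
  then have "K ` W \<subseteq> level X n"
    by blast
  moreover have "inj_on K W"
  proof (rule inj_onI, rule ccontr)
    fix w w'
    assume w: "w \<in> W" "w' \<in> W" and eq: "K w = K w'" and "w \<noteq> w'"
    then obtain i j where ij: "i \<in> {1..n}" "j \<in> {1..n}" "i \<noteq> j"
        "\<chi> {f w i, f w j} \<noteq> \<chi> {f w' i, f w' j}"
      using sep by blast
    then obtain i' j' where ij': "i' \<in> {1..n}" "j' \<in> {1..n}" "i = \<sigma> i'" "j = \<sigma> j'"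
      using \<sigma>(1) by (metis bij_betw_imp_surj_on imageE)
    then have e: "{i', j'} \<in> nsets {1..n} 2"
      using ij by auto
    have "snd (K w) {i', j'} = snd (K w') {i', j'}"
      by (simp only: eq)
    then have "\<chi> ((f w \<circ> \<sigma>) ` {i', j'}) = \<chi> ((f w' \<circ> \<sigma>) ` {i', j'})"
      by (simp only: K_def snd_conv restrict_apply' e)
    then show False
      using ij ij' by simp
  qed
  ultimately show ?thesis
    using assms(2) by (simp add: card_inj_on_le)
qed simp

section \<open>Sparse sets and the Fibonacci numbers\<close>

definition sparse_sets :: "nat \<Rightarrow> nat set set" where
  "sparse_sets n = {S. S \<subseteq> {1..<n} \<and> (\<forall>i\<in>S. Suc i \<notin> S)}"

lemma sparse_setsD:
  assumes "S \<in> sparse_sets n"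
  shows "i \<in> S \<Longrightarrow> 1 \<le> i" "i \<in> S \<Longrightarrow> Suc i \<le> n" "i \<in> S \<Longrightarrow> Suc i \<notin> S"
  using assms by (auto simp: sparse_sets_def)

lemma finite_sparse_sets: "finite (sparse_sets n)"
  by (rule finite_subset[of _ "Pow {1..<n}"]) (auto simp: sparse_sets_def)

text \<open>The Fibonacci recursion comes from asking whether the largest admissible element
  \<open>Suc n\<close> is present: if it is, \<open>n\<close> is absent and the rest lies in
  \<open>sparse_sets n\<close>.\<close>

lemma shifted_fib_le_card_sparse_sets: "shifted_fib n \<le> card (sparse_sets n)"
proof (induction n rule: induct_nat_012)
  case 0
  have "sparse_sets 0 = {{}}" by (auto simp: sparse_sets_def)
  then show ?case by (simp add: shifted_fib_simps)
next
  case 1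
  have "sparse_sets 1 = {{}}" by (auto simp: sparse_sets_def)
  then show ?case by (simp add: shifted_fib_simps)
next
  case (ge2 n)
  have notin: "Suc n \<notin> S" if "S \<in> sparse_sets n \<or> S \<in> sparse_sets (Suc n)" for S
    using that by (auto simp: sparse_sets_def)
  have "inj_on (insert (Suc n)) (sparse_sets n)"
    using notin by (intro inj_onI) (metis insert_ident)
  then have "card (sparse_sets (Suc n) \<union> insert (Suc n) ` sparse_sets n)
      = card (sparse_sets (Suc n)) + card (sparse_sets n)"
    using notin by (subst card_Un_disjoint) (auto simp: finite_sparse_sets card_image)
  moreover have "sparse_sets (Suc n) \<union> insert (Suc n) ` sparse_sets n \<subseteq> sparse_sets (Suc (Suc n))"
    by (force simp: sparse_sets_def)
  ultimately have "card (sparse_sets (Suc n)) + card (sparse_sets n) \<le> card (sparse_sets (Suc (Suc n)))"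
    by (metis card_mono finite_sparse_sets)
  then show ?case
    using ge2 by (simp add: shifted_fib_simps)
qed

text \<open>A template for all encodings: \<open>R\<close> is the order pattern shared by all
  \<open>f S\<close>, and the color between the points with indices \<open>i\<close> and
  \<open>t i\<close> reveals whether \<open>i\<close> is in \<open>S\<close>.\<close>

lemma card_level_ge_fib:
  assumes "hereditary X" "finite (level X n)" "(N, \<chi>) \<in> X"
    and range: "\<And>S i. S \<in> sparse_sets n \<Longrightarrow> i \<in> {1..n} \<Longrightarrow> f S i \<in> {1..N}"
    and ord: "\<And>S i j. S \<in> sparse_sets n \<Longrightarrow> i \<in> {1..n} \<Longrightarrow> j \<in> {1..n} \<Longrightarrow> i < j \<Longrightarrow>
                if R i j then f S i < f S j else f S j < f S i"
    and sep: "\<And>S i. S \<in> sparse_sets n \<Longrightarrow> i \<in> {1..<n} \<Longrightarrow>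
                \<chi> {f S i, f S (t i)} = (if i \<in> S then p i else q i)"
    and t: "\<And>i. i \<in> {1..<n} \<Longrightarrow> t i \<in> {1..n} \<and> t i \<noteq> i \<and> p i \<noteq> q i"
  shows "shifted_fib n \<le> card (level X n)"
proof -
  have "card (sparse_sets n) \<le> card (level X n)"
  proof (rule card_level_ge_family[OF assms(1-3) range])
    show "inj_on (f S) {1..n}" if "S \<in> sparse_sets n" for S
    proof (rule linorder_inj_onI)
      show "f S i \<noteq> f S j" if "i < j" "i \<in> {1..n}" "j \<in> {1..n}" for i j
        using ord[OF \<open>S \<in> sparse_sets n\<close> that(2,3,1)] by (auto split: if_splits)
    qed auto
    show "f S' i < f S' j"
      if "S \<in> sparse_sets n" "S' \<in> sparse_sets n" "i \<in> {1..n}" "j \<in> {1..n}" "f S i < f S j" for S S' i j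
      using ord[of S i j] ord[of S' i j] ord[of S j i] ord[of S' j i] that
      by (cases i j rule: linorder_cases) (auto split: if_splits)
    show "\<exists>i\<in>{1..n}. \<exists>j\<in>{1..n}. i \<noteq> j \<and> \<chi> {f S i, f S j} \<noteq> \<chi> {f S' i, f S' j}"
      if S: "S \<in> sparse_sets n" "S' \<in> sparse_sets n" "S \<noteq> S'" for S S'
    proof -
      obtain i where i: "i \<in> S \<longleftrightarrow> i \<notin> S'"
        using S(3) by blast
      then have "i \<in> {1..<n}"
        using S by (auto simp: sparse_sets_def)
      then show ?thesis
        using i t[of i] sep[of S i] sep[of S' i] S
        by (intro bexI[of _ i] bexI[of _ "t i"]) (auto split: if_splits)
    qed
  qed
  then show ?thesis
    using shifted_fib_le_card_sparse_sets[of n] by linarith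
qed

subsection \<open>Structures with Fibonacci growth\<close>

text \<open>Each \<open>k\<close> below \<open>n\<close> contributes \<open>u k\<close> or
  \<open>v k\<close>, and its color to \<open>z\<close>, the point with index \<open>n\<close>,
  tells which one was chosen.\<close>

lemma card_level_ge_fib_fixed_point:
  assumes "hereditary X" "finite (level X n)" "(N, \<chi>) \<in> X" and n: "1 \<le> n"
    and range: "z \<in> {1..N}" "\<And>k. k \<in> {1..<n} \<Longrightarrow> u k \<in> {1..N} \<and> v k \<in> {1..N}"
    and incr: "\<And>k l. k \<in> {1..<n} \<Longrightarrow> l \<in> {1..<n} \<Longrightarrow> k < l \<Longrightarrow>
                 u k < u l \<and> u k < v l \<and> v k < u l \<and> v k < v l"
    and side: "(\<forall>k\<in>{1..<n}. z < u k \<and> z < v k) \<or> (\<forall>k\<in>{1..<n}. u k < z \<and> v k < z)"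
    and col: "\<And>k. k \<in> {1..<n} \<Longrightarrow> \<chi> {z, u k} = \<alpha> \<and> \<chi> {z, v k} = \<beta>" and "\<alpha> \<noteq> \<beta>"
  shows "shifted_fib n \<le> card (level X n)"
proof -
  define f where "f S i = (if i = n then z else if i \<in> S then u i else v i)" for S i
  show ?thesis
  proof (rule card_level_ge_fib[OF assms(1-3), of f])
    fix S i assume "i \<in> {1..n}"
    then show "f S i \<in> {1..N}"
      using range(1) range(2)[of i] by (auto simp: f_def)
  next
    fix S i j assume ij: "i \<in> {1..n}" "j \<in> {1..n}" "i < j"
    show "if j < n \<or> (\<forall>k\<in>{1..<n}. u k < z \<and> v k < z) then f S i < f S j else f S j < f S i"
    proof (cases "j = n")
      case True
      then show ?thesis
        using ij side by (auto simp: f_def)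
    next
      case False
      then have "i \<in> {1..<n}" "j \<in> {1..<n}"
        using ij by auto
      then show ?thesis
        using incr[OF _ _ ij(3)] by (auto simp: f_def)
    qed
  next
    fix S i assume "i \<in> {1..<n}"
    then show "\<chi> {f S i, f S n} = (if i \<in> S then \<alpha> else \<beta>)"
      using col[of i] by (auto simp: f_def insert_commute)
  qed (use n \<open>\<alpha> \<noteq> \<beta>\<close> in auto)
qed

text \<open>The points with indices \<open>i\<close> and \<open>i + 1\<close> form the pair
  \<open>u i\<close>, \<open>v i\<close> if \<open>i \<in> S\<close>; otherwise they come from
  different pairs and have color \<open>\<gamma>\<close>. Sparseness keeps a point from being needed
  in two pairs.\<close>

lemma card_level_ge_fib_matching:
  assumes "hereditary X" "finite (level X n)" "(N, \<chi>) \<in> X"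
    and range: "\<And>k. k \<in> {1..n} \<Longrightarrow> u k \<in> {1..N} \<and> v k \<in> {1..N} \<and> u k < v k"
    and incr: "\<And>k l. k \<in> {1..n} \<Longrightarrow> l \<in> {1..n} \<Longrightarrow> k < l \<Longrightarrow> v k < u l"
    and col1: "\<And>k. k \<in> {1..n} \<Longrightarrow> \<chi> {u k, v k} = \<eta>"
    and col2: "\<And>k l. k \<in> {1..n} \<Longrightarrow> l \<in> {1..n} \<Longrightarrow> k < l \<Longrightarrow>
                 \<chi> {u k, u l} = \<gamma> \<and> \<chi> {v k, u l} = \<gamma>"
    and "\<eta> \<noteq> \<gamma>"
  shows "shifted_fib n \<le> card (level X n)"
proof -
  \<comment> \<open>For \<open>i = 1\<close> the test concerns 0, which no sparse set contains, so
    the first point is \<open>u 1\<close>.\<close>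
  define f where "f S i = (if i - 1 \<in> S then v (i - 1) else u i)" for S i
  show ?thesis
  proof (rule card_level_ge_fib[OF assms(1-3), of f])
    fix S i assume S: "S \<in> sparse_sets n" and i: "i \<in> {1..n}"
    have "f S i = v (i - 1) \<and> i - 1 \<in> {1..n} \<or> f S i = u i"
      using i sparse_setsD(1)[OF S, of "i - 1"] by (auto simp: f_def)
    then show "f S i \<in> {1..N}"
      using range[of i] range[of "i - 1"] i by auto
  next
    fix S i j assume S: "S \<in> sparse_sets n" and ij: "i \<in> {1..n}" "j \<in> {1..n}" "i < j"
    \<comment> \<open>The pair with index \<open>i\<close> separates the points:
      \<open>f S i \<le> u i < v i \<le> f S j\<close>.\<close>
    have "f S i \<le> u i"
      using incr[of "i - 1" i] sparse_setsD(1)[OF S, of "i - 1"] ij(1) by (auto simp: f_def)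
    moreover have "v i \<le> f S j"
    proof (cases "i = j - 1")
      case True
      then show ?thesis
        using incr[of i j] ij by (auto simp: f_def)
    next
      case False
      then have "j - 1 \<in> {1..n}" "i < j - 1"
        using ij by auto
      then have "v i < u j" "v i < u (j - 1)" "u (j - 1) < v (j - 1)"
        using incr range ij by blast+
      then show ?thesis
        by (auto simp: f_def)
    qed
    ultimately show "if True then f S i < f S j else f S j < f S i"
      using range[of i] ij by simp
  next
    fix S i assume S: "S \<in> sparse_sets n" and i: "i \<in> {1..<n}"
    have "i - 1 \<notin> S" if "i \<in> S"
      using sparse_setsD(3)[OF S, of "i - 1"] that i by auto
    moreover have "i - 1 \<in> {1..n}" if "i - 1 \<in> S"
      using sparse_setsD(1)[OF S, of "i - 1"] that i by auto
    ultimately show "\<chi> {f S i, f S (Suc i)} = (if i \<in> S then \<eta> else \<gamma>)"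
      using i col1[of i] col2[of i "Suc i"] col2[of "i - 1" "Suc i"] by (auto simp: f_def)
  qed (use \<open>\<eta> \<noteq> \<gamma>\<close> in auto)
qed

text \<open>If the color at equal indices differs from a common color at distinct indices, then \<open>i \<in> S\<close> is
  encoded by giving the \<open>i\<close>th and the \<open>i + 1\<close>st point the same index. Otherwise it is encoded by
  exchanging the indices of these two points.\<close>

lemma card_level_ge_fib_bipartite:
  assumes "hereditary X" "finite (level X n)" "(N, \<chi>) \<in> X"
    and range: "\<And>k. k \<in> {1..n} \<Longrightarrow> y k \<in> {1..N} \<and> x k \<in> {1..N}"
    and y_incr: "\<And>k l. k \<in> {1..n} \<Longrightarrow> l \<in> {1..n} \<Longrightarrow> k < l \<Longrightarrow> y k < y l"
    and x_mono: "\<And>k l. k \<in> {1..n} \<Longrightarrow> l \<in> {1..n} \<Longrightarrow> k < l \<Longrightarrow>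
                   if inc then x k < x l else x l < x k"
    and side: "\<And>k l. k \<in> {1..n} \<Longrightarrow> l \<in> {1..n} \<Longrightarrow> if right then y k < x l else x l < y k"
    and col: "\<And>k l. k \<in> {1..n} \<Longrightarrow> l \<in> {1..n} \<Longrightarrow>
                \<chi> {y k, x l} = (if k < l then \<delta> else if l < k then \<epsilon> else \<eta>)"
    and neq: "\<delta> \<noteq> \<epsilon> \<or> \<eta> \<noteq> \<delta>"
  shows "shifted_fib n \<le> card (level X n)"
proof -
  \<comment> \<open>Odd indices go to the \<open>y\<close> side and even ones to the
    \<open>x\<close> side, so neighbors lie on opposite sides. The order of indices matters only
    within a side, which leaves \<open>\<tau>\<close> free to identify or exchange
    neighbors.\<close>
  have fib_le: ?thesis
    if \<tau>_range: "\<And>S i. S \<in> sparse_sets n \<Longrightarrow> i \<in> {1..n} \<Longrightarrow> \<tau> S i \<in> {1..n}"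
      and \<tau>_mono: "\<And>S i j. S \<in> sparse_sets n \<Longrightarrow> i \<in> {1..n} \<Longrightarrow> j \<in> {1..n} \<Longrightarrow> i + 2 \<le> j \<Longrightarrow>
                      \<tau> S i < \<tau> S j"
      and \<tau>_col: "\<And>S i. S \<in> sparse_sets n \<Longrightarrow> i \<in> {1..<n} \<Longrightarrow>
              (if \<tau> S i < \<tau> S (Suc i) then if odd i then \<delta> else \<epsilon>
               else if \<tau> S (Suc i) < \<tau> S i then if odd i then \<epsilon> else \<delta> else \<eta>)
               = (if i \<in> S then p i else q i)"
      and pq: "\<And>i. i \<in> {1..<n} \<Longrightarrow> p i \<noteq> q i" for \<tau> p q
  proof -
    define f where "f S i = (if odd i then y (\<tau> S i) else x (\<tau> S i))" for S i
    show ?thesis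
    proof (rule card_level_ge_fib[OF assms(1-3), of f])
      fix S i assume "S \<in> sparse_sets n" "i \<in> {1..n}"
      then show "f S i \<in> {1..N}"
        using range[OF \<tau>_range] by (auto simp: f_def)
    next
      fix S i j assume S: "S \<in> sparse_sets n" and ij: "i \<in> {1..n}" "j \<in> {1..n}" "i < j"
      have "\<tau> S i < \<tau> S j" if "odd i \<longleftrightarrow> odd j"
      proof -
        have "i + 2 \<le> j"
          using ij(3) that by presburger
        then show ?thesis
          using \<tau>_mono[OF S ij(1,2)] by simp
      qed
      then show "if (if odd i then odd j \<or> right else if odd j then \<not> right else inc)
          then f S i < f S j else f S j < f S i"
        using y_incr[OF \<tau>_range[OF S ij(1)] \<tau>_range[OF S ij(2)]]
          x_mono[OF \<tau>_range[OF S ij(1)] \<tau>_range[OF S ij(2)]]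
          side[OF \<tau>_range[OF S ij(1)] \<tau>_range[OF S ij(2)]]
          side[OF \<tau>_range[OF S ij(2)] \<tau>_range[OF S ij(1)]]
        by (cases "odd i"; cases "odd j") (auto simp: f_def)
    next
      fix S i assume S: "S \<in> sparse_sets n" and i: "i \<in> {1..<n}"
      then have "i \<in> {1..n}" "Suc i \<in> {1..n}"
        by auto
      note \<tau> = \<tau>_range[OF S this(1)] \<tau>_range[OF S this(2)]
      show "\<chi> {f S i, f S (Suc i)} = (if i \<in> S then p i else q i)"
        unfolding \<tau>_col[OF S i, symmetric]
        using col[OF \<tau>] col[OF \<tau>(2,1)] by (auto simp: f_def insert_commute)
    qed (use pq in auto)
  qed
  show ?thesis
  proof (cases "\<delta> = \<epsilon>")
    case True
    show ?thesis
    proof (rule fib_le[of "\<lambda>S i. if i - 1 \<in> S then i - 1 else i" "\<lambda>_. \<eta>" "\<lambda>_. \<delta>"])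
      fix S i assume S: "S \<in> sparse_sets n" and i: "i \<in> {1..n}"
      then show "(if i - 1 \<in> S then i - 1 else i) \<in> {1..n}"
        using sparse_setsD(1)[OF S, of "i - 1"] by auto
    next
      fix S i assume S: "S \<in> sparse_sets n" and i: "i \<in> {1..<n}"
      have "i - 1 \<notin> S" if "i \<in> S"
        using sparse_setsD(3)[OF S, of "i - 1"] that i by auto
      then show "(if (if i - 1 \<in> S then i - 1 else i) < (if Suc i - 1 \<in> S then Suc i - 1 else Suc i)
              then if odd i then \<delta> else \<epsilon>
            else if (if Suc i - 1 \<in> S then Suc i - 1 else Suc i) < (if i - 1 \<in> S then i - 1 else i)
              then if odd i then \<epsilon> else \<delta> else \<eta>) = (if i \<in> S then \<eta> else \<delta>)"
        using True by auto
    qed (use True neq in auto)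
  next
    case False
    define \<tau> :: "nat set \<Rightarrow> nat \<Rightarrow> nat"
      where "\<tau> S i = (if i \<in> S then i + 1 else if i - 1 \<in> S then i - 1 else i)" for S i
    show ?thesis
    proof (rule fib_le[of \<tau> "\<lambda>i. if odd i then \<epsilon> else \<delta>" "\<lambda>i. if odd i then \<delta> else \<epsilon>"])
      fix S i assume S: "S \<in> sparse_sets n" and i: "i \<in> {1..n}"
      then show "\<tau> S i \<in> {1..n}"
        using sparse_setsD(1)[OF S, of "i - 1"] sparse_setsD(2)[OF S, of i] by (auto simp: \<tau>_def)
    next
      fix S i j assume S: "S \<in> sparse_sets n" and ij: "i \<in> {1..n}" "j \<in> {1..n}" "i + 2 \<le> j"
      \<comment> \<open>The only possible collision is \<open>i\<close> moving up and
        \<open>i + 2\<close> moving down to \<open>i + 1\<close>, which needs both \<open>i\<close>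
        and \<open>i + 1\<close> in \<open>S\<close>.\<close>
      have "\<not> (i \<in> S \<and> j - 1 \<in> S \<and> j = i + 2)"
        using sparse_setsD(3)[OF S, of i] by auto
      then show "\<tau> S i < \<tau> S j"
        using ij(3) by (auto simp: \<tau>_def)
    next
      fix S i assume S: "S \<in> sparse_sets n" and i: "i \<in> {1..<n}"
      show "(if \<tau> S i < \<tau> S (Suc i) then if odd i then \<delta> else \<epsilon>
          else if \<tau> S (Suc i) < \<tau> S i then if odd i then \<epsilon> else \<delta> else \<eta>)
          = (if i \<in> S then if odd i then \<epsilon> else \<delta> else if odd i then \<delta> else \<epsilon>)"
        using sparse_setsD(3)[OF S, of i] by (auto simp: \<tau>_def)
    qed (use False in auto)
  qed
qed

subsection \<open>Homogeneous non-twins\<close>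

text \<open>The bound \<open>q\<close> is fixed before \<open>F\<close>. A function of ordered pairs
  becomes a coloring of 2-sets by reading off minimum and maximum, and its values are numbered by
  \<open>idx\<close>.\<close>

lemma ramsey_pairs:
  fixes T :: "'c set" and m :: nat
  assumes "finite T"
  shows "\<exists>q :: nat. \<forall>F :: nat \<Rightarrow> nat \<Rightarrow> 'c. (\<forall>k l. k < l \<and> l < q \<longrightarrow> F k l \<in> T) \<longrightarrow>
    (\<exists>h c. h \<in> {..<m} \<rightarrow> {..<q} \<and> strict_mono_on {..<m} h \<and>
      (\<forall>k l. k < l \<and> l < m \<longrightarrow> F (h k) (h l) = c))"
proof -
  obtain idx where idx: "bij_betw idx T {0..<card T}"
    using ex_bij_betw_finite_nat[OF assms] by blast
  obtain q :: nat where q: "partn_lst {..<q} (replicate (card T) m) 2"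
    using ramsey_full by blast
  have "\<exists>h c. h \<in> {..<m} \<rightarrow> {..<q} \<and> strict_mono_on {..<m} h \<and>
      (\<forall>k l. k < l \<and> l < m \<longrightarrow> F (h k) (h l) = c)"
    if F: "\<forall>k l. k < l \<and> l < q \<longrightarrow> F k l \<in> T" for F
  proof -
    define f where "f e = idx (F (Min e) (Max e))" for e
    have mem: "F (Min e) (Max e) \<in> T" if "e \<in> nsets {..<q} 2" for e
      using that F by (auto simp: ordered_nsets_2_eq)
    have "f \<in> nsets {..<q} 2 \<rightarrow> {..<length (replicate (card T) m)}"
      using bij_betwE[OF idx] mem by (auto simp: f_def)
    then obtain i where "i < card T" "monochromatic {..<q} m 2 f i"
      using q unfolding partn_lst_def by fastforce
    then obtain H where H: "H \<in> nsets {..<q} m" "f ` nsets H 2 \<subseteq> {i}"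
      unfolding monochromatic_def by blast
    then have "finite H" "card H = m" "H \<subseteq> {..<q}"
      by (auto simp: nsets_def)
    then obtain h where h: "bij_betw h {..<m} H" "strict_mono_on {..<m} h"
      using ex_bij_betw_strict_mono_card by metis
    have "F (h k) (h l) = inv_into T idx i" if kl: "k < l" "l < m" for k l
    proof -
      have lt: "h k < h l"
        using strict_mono_onD[OF h(2)] kl by auto
      moreover have "h k \<in> H" "h l \<in> H"
        using bij_betwE[OF h(1)] kl by auto
      ultimately have e: "{h k, h l} \<in> nsets H 2"
        by auto
      then have "f {h k, h l} = i"
        using H(2) by blast
      moreover have "Min {h k, h l} = h k" "Max {h k, h l} = h l"
        using lt by auto
      moreover have "{h k, h l} \<in> nsets {..<q} 2"
        using e \<open>H \<subseteq> {..<q}\<close> nsets_mono by blast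
      ultimately show ?thesis
        using mem[of "{h k, h l}"] idx by (auto simp: f_def bij_betw_def)
    qed
    moreover have "h \<in> {..<m} \<rightarrow> {..<q}"
      using bij_betwE[OF h(1)] \<open>H \<subseteq> {..<q}\<close> by auto
    ultimately show ?thesis
      using h(2) by blast
  qed
  then show ?thesis
    by blast
qed

text \<open>Packing all data into one value lets a single use of Ramsey's theorem make them uniform.
  With both strict comparisons, coincidence of points is seen too; the last two entries concern
  index \<open>k\<close> alone.\<close>

definition profile ::
  "(nat set \<Rightarrow> 'p) \<Rightarrow> ('s \<Rightarrow> nat \<Rightarrow> nat) \<Rightarrow> nat \<Rightarrow> nat \<Rightarrow> 's \<times> 's \<Rightarrow> 'p \<times> bool \<times> bool \<times> 'p \<times> bool"
where
  "profile \<chi> pt k l = (\<lambda>(s, t). (\<chi> {pt s k, pt t l}, pt s k < pt t l, pt t l < pt s k,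
     \<chi> {pt s k, pt t k}, pt s k < pt t k))"

text \<open>All values of \<open>\<chi>\<close> must lie in \<open>C\<close>, not only those at
  pairs: selected points may coincide, and then a color is read off a singleton.\<close>

lemma ramsey_profile:
  fixes m :: nat
  assumes "finite C"
  shows "\<exists>q :: nat. \<forall>\<chi> (pt :: 's::finite \<Rightarrow> nat \<Rightarrow> nat). range \<chi> \<subseteq> C \<longrightarrow>
    (\<exists>h c. h \<in> {..<m} \<rightarrow> {..<q} \<and> strict_mono_on {..<m} h \<and>
      (\<forall>k l. k < l \<and> l < m \<longrightarrow> profile \<chi> pt (h k) (h l) = c))"
proof -
  define T :: "('s \<times> 's \<Rightarrow> 'a \<times> bool \<times> bool \<times> 'a \<times> bool) set"
    where "T = UNIV \<rightarrow>\<^sub>E C \<times> UNIV \<times> UNIV \<times> C \<times> UNIV"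
  have "finite T"
    using assms by (auto simp: T_def intro!: finite_PiE)
  moreover have "profile \<chi> pt k l \<in> T" if "range \<chi> \<subseteq> C" for \<chi> pt k l
    using that by (auto simp: T_def profile_def)
  moreover obtain q :: nat where "\<forall>F :: nat \<Rightarrow> nat \<Rightarrow> _. (\<forall>k l. k < l \<and> l < q \<longrightarrow> F k l \<in> T) \<longrightarrow>
    (\<exists>h c. h \<in> {..<m} \<rightarrow> {..<q} \<and> strict_mono_on {..<m} h \<and>
      (\<forall>k l. k < l \<and> l < m \<longrightarrow> F (h k) (h l) = c))"
    using ramsey_pairs[OF \<open>finite T\<close>, of m] by (elim exE)
  ultimately show ?thesis
    by (intro exI[of _ q]) auto
qed

datatype vertex = A | B | W

instance vertex :: finite
proof
  have "(UNIV :: vertex set) \<subseteq> {A, B, W}"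
    using vertex.exhaust by auto
  then show "finite (UNIV :: vertex set)"
    by (rule finite_subset) simp
qed

text \<open>\<open>A\<close> and \<open>B\<close> are the two members of a pair of adjacent non-twins, \<open>W\<close> is a witness.\<close>

lemma card_level_ge_fib_homogeneous:
  fixes pt :: "vertex \<Rightarrow> nat \<Rightarrow> nat"
  assumes "hereditary X" "finite (level X n)" "(N, \<chi>) \<in> X" and n: "1 \<le> n"
    and range: "\<And>s k. k < n + 3 \<Longrightarrow> pt s k \<in> {1..N}"
    and hom: "\<And>k l. k < l \<Longrightarrow> l < n + 3 \<Longrightarrow> profile \<chi> pt k l = c"
    and Suc: "\<And>k. k < n + 3 \<Longrightarrow> pt B k = Suc (pt A k)"
    and incr: "\<And>k l. k < l \<Longrightarrow> l < n + 3 \<Longrightarrow> pt A k < pt A l"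
    and witness: "\<And>k. k < n + 3 \<Longrightarrow> pt W k \<noteq> pt A k \<and> pt W k \<noteq> pt B k \<and>
                    \<chi> {pt A k, pt W k} \<noteq> \<chi> {pt B k, pt W k}"
  shows "shifted_fib n \<le> card (level X n)"
proof (rule ccontr)
  assume less: "\<not> shifted_fib n \<le> card (level X n)"
  define C where "C s t = \<chi> {pt s 0, pt t 1}" for s t
  define L where "L s t \<longleftrightarrow> pt s 0 < pt t 1" for s t
  define G where "G s t \<longleftrightarrow> pt t 1 < pt s 0" for s t
  have eq: "profile \<chi> pt k l (s, t) = profile \<chi> pt 0 1 (s, t)" if "k < l" "l < n + 3" for k l s t
    using hom[OF that] hom[of 0 1] by simp
  have C: "\<chi> {pt s k, pt t l} = C s t" and L: "pt s k < pt t l \<longleftrightarrow> L s t"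
    and G: "pt t l < pt s k \<longleftrightarrow> G s t" if "k < l" "l < n + 3" for k l s t
    using eq[OF that, of s t] by (simp_all add: profile_def C_def L_def G_def)
  have C0: "\<chi> {pt s k, pt t k} = \<chi> {pt s 0, pt t 0}" and L0: "pt s k < pt t k \<longleftrightarrow> pt s 0 < pt t 0"
    if "k < n + 2" for k s t
    using eq[of k "Suc k" s t] that by (simp_all add: profile_def)
  \<comment> \<open>If \<open>t\<close> and \<open>t'\<close> interleave on one side of
    \<open>s\<close>, two different colors would make \<open>pt s 0\<close> the fixed point of a
    Fibonacci structure.\<close>
  have fwd: "C s t = C s t'"
    if "L t t" "L t t'" "L t' t" "L t' t'" "L s t \<and> L s t' \<or> G s t \<and> G s t'" for s t t'
  proof (rule ccontr)
    assume "C s t \<noteq> C s t'"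
    then have "shifted_fib n \<le> card (level X n)"
      using that
      by (intro card_level_ge_fib_fixed_point[OF assms(1-4), of "pt s 0" "pt t" "pt t'"])
        (auto simp: range[simplified] C L G)
    then show False
      using less by simp
  qed
  \<comment> \<open>The mirror image of \<open>fwd\<close>, with the last point
    \<open>pt s (n + 2)\<close> as the fixed point.\<close>
  have bwd: "C t s = C t' s"
    if "L t t" "L t t'" "L t' t" "L t' t'" "L t s \<and> L t' s \<or> G t s \<and> G t' s" for s t t'
  proof (rule ccontr)
    assume "C t s \<noteq> C t' s"
    then have "shifted_fib n \<le> card (level X n)"
      using that
      by (intro card_level_ge_fib_fixed_point[OF assms(1-4), of "pt s (n + 2)" "pt t" "pt t'"])
        (auto simp: range[simplified] L G insert_commute[of "pt s (Suc (Suc n))"] C)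
    then show False
      using less by simp
  qed
  have "pt B 0 < pt A 2" "pt B 0 < pt B 2" "pt A 0 < pt B 2"
    using incr[of 0 1] incr[of 1 2] Suc[of 0] Suc[of 2] by auto
  then have AB: "L A A" "L A B" "L B A" "L B B"
    using incr[of 0 1] L[of 0 1 A A] L[of 0 2 B A] L[of 0 2 B B] L[of 0 2 A B] by auto
  \<comment> \<open>Equality would force \<open>pt s 0 = pt s 1\<close> and
    \<open>pt t 1 = pt t 2\<close>, but one of the two sequences increases.\<close>
  have neq: "L s t \<or> G s t" if "L s s \<or> L t t" for s t
  proof (rule ccontr)
    assume "\<not> (L s t \<or> G s t)"
    then have "pt s 0 = pt t 1" "pt s 0 = pt t 2" "pt s 1 = pt t 2"
      using L[of 0 1 s t] L[of 0 2 s t] L[of 1 2 s t] G[of 0 1 t s] G[of 0 2 t s] G[of 1 2 t s] by auto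
    then show False
      using that L[of 0 1 s s] L[of 1 2 t t] by auto
  qed
  have A_neq: "L A W \<or> G A W" and B_neq: "L B W \<or> G B W"
    and neq_A: "L W A \<or> G W A" and neq_B: "L W B \<or> G W B"
    using neq AB by auto
  \<comment> \<open>No point lies strictly between \<open>pt A k\<close> and \<open>pt B k\<close>,
    so a point different from both is on the same side of both.\<close>
  have LW: "L A W \<longleftrightarrow> L B W" and LW': "L W A \<longleftrightarrow> L W B"
    using A_neq B_neq neq_A neq_B Suc[of 0] Suc[of 1] by (auto simp: L_def G_def)
  have L_or_G: "\<not> (L s t \<and> G s t)" for s t
    by (auto simp: L_def G_def)
  \<comment> \<open>Across distinct indices the colors do not tell \<open>A\<close> from
    \<open>B\<close>, so only the color at equal indices does.\<close>
  have AB_col: "C A B = C A A" "C B A = C A A" "C B B = C A A"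
    using fwd[of A B A] fwd[of B A B] bwd[of A B A] AB by auto
  have AW: "C B W = C A W"
    using bwd[of A B W] AB A_neq B_neq LW by auto
  have WA: "C W B = C W A"
    using fwd[of A B W] AB neq_A neq_B LW' by auto
  \<comment> \<open>If the witness did not move, \<open>AW\<close> would contradict the choice of
    \<open>pt W 0\<close>.\<close>
  have WW: "L W W \<or> G W W"
  proof (rule ccontr)
    assume "\<not> (L W W \<or> G W W)"
    then have "pt W 1 = pt W 0"
      by (auto simp: L_def G_def)
    then show False
      using AW witness[of 0] by (auto simp: C_def)
  qed
  define right where "right \<longleftrightarrow> pt A 0 < pt W 0"
  \<comment> \<open>At least one of \<open>A\<close> and \<open>B\<close> has a color to its own
    witness that differs from the color \<open>C A W\<close> to later witnesses; that one is
    kept.\<close>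
  define s where "s = (if \<chi> {pt A 0, pt W 0} = C A W then B else A)"
  define \<eta> where "\<eta> = \<chi> {pt s 0, pt W 0}"
  have s: "s = A \<or> s = B" and \<eta>: "\<eta> \<noteq> C A W"
    using witness[of 0] by (auto simp: s_def \<eta>_def)
  have s_eq: "L s W = L A W" "L W s = L W A" "L s s" "G s W = G A W" "G W s = G W A"
      "C s W = C A W" "C W s = C W A" "C s s = C A A"
    using s AB A_neq B_neq neq_A neq_B LW LW' AW WA AB_col L_or_G by auto
  have right: "if right then pt s k < pt W k else pt W k < pt s k" if "k < n + 2" for k
    using s Suc[of k] witness[of k] that L0[OF that, of A W] by (auto simp: right_def)
  have col0: "\<chi> {pt s k, pt W k} = \<eta>" "\<chi> {pt W k, pt s k} = \<eta>" if "k < n + 2" for k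
    unfolding \<eta>_def using C0[OF that, of s W] by (simp_all add: insert_commute)
  show False
  \<comment> \<open>Either each pair of \<open>s\<close> and its witness lies entirely before all
    later pairs, which gives a matching, or all \<open>s\<close> points lie on one side of all
    witnesses.\<close>
  proof (cases "if right then L W A else L A W")
    case True
    have LWW: "L W W" and LWA: "L W A" "L A W"
      using True right[of 0] right[of 1] s_eq L_def[of s W] L_def[of W s] L_def[of W W]
        L_def[of s s] by (auto split: if_splits)
    \<comment> \<open>Here \<open>A\<close> and \<open>W\<close> interleave, so only one color
      occurs across distinct indices.\<close>
    have "C A W = C A A"
      using fwd[of A W A] AB LWW LWA by auto
    moreover have "C W A = C A A"
      using bwd[of A W A] AB LWW LWA by auto
    moreover have "C W W = C W A"
      using fwd[of A W W] AB LWW LWA by auto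
    ultimately have same: "C s W = C A A" "C W s = C A A" "C W W = C A A" "C s s = C A A"
      using s_eq by auto
    have "shifted_fib n \<le> card (level X n)"
    proof (cases right)
      case True
      show ?thesis
      proof (rule card_level_ge_fib_matching[OF assms(1-3), of "pt s" "pt W" \<eta> "C A A"])
        show "\<eta> \<noteq> C A A"
          using \<eta> s_eq same by simp
      qed (use True right range s_eq LWA L same C col0 in auto)
    next
      case False
      show ?thesis
      proof (rule card_level_ge_fib_matching[OF assms(1-3), of "pt W" "pt s" \<eta> "C A A"])
        show "\<eta> \<noteq> C A A"
          using \<eta> s_eq same by simp
      qed (use False right range s_eq LWA L same C col0 in auto)
    qed
    then show False
      using less by simp
  next
    case False
    have split: "if right then pt s k < pt W l else pt W l < pt s k"
      if kl: "k \<in> {1..n}" "l \<in> {1..n}" for k l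
    proof (cases k l rule: linorder_cases)
      case less
      then show ?thesis
        using False right[of l] L[of k l s s] G[of k l W s] s_eq A_neq kl by (auto split: if_splits)
    next
      case equal
      then show ?thesis
        using right[of l] kl by auto
    next
      case greater
      then show ?thesis
        using False right[of l] L[of l k s s] G[of l k s W] s_eq neq_A kl by (auto split: if_splits)
    qed
    have "shifted_fib n \<le> card (level X n)"
    \<comment> \<open>The witnesses may run in either direction, as recorded by
      \<open>L W W\<close>; the choice of \<open>s\<close> makes \<open>\<eta>\<close> differ from
      \<open>C s W\<close>.\<close>
    proof (rule card_level_ge_fib_bipartite[OF assms(1-3), of "pt s" "pt W" "L W W" right
          "C s W" "C W s" \<eta>])
      fix k l assume kl: "k \<in> {1..n}" "l \<in> {1..n}"
      show "\<chi> {pt s k, pt W l} =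
          (if k < l then C s W else if l < k then C W s else \<eta>)"
        using kl C[of k l s W] C[of l k W s] col0(1)[of k]
        by (cases k l rule: linorder_cases) (auto simp: insert_commute)
      show "if right then pt s k < pt W l else pt W l < pt s k"
        using split[OF kl] .
      assume "k < l"
      then show "pt s k < pt s l" "if L W W then pt W k < pt W l else pt W l < pt W k"
        using kl L[of k l] G[of k l] s_eq WW by auto
    qed (use \<eta> s_eq range in auto)
    then show False
      using less by simp
  qed
qed

subsection \<open>Polynomial growth\<close>

definition nontwins :: "'p coloring \<Rightarrow> nat set" where
  "nontwins K = (case K of (N, \<chi>) \<Rightarrow>
     {i \<in> {1..<N}. \<exists>x\<in>{1..N} - {i, Suc i}. \<chi> {x, i} \<noteq> \<chi> {x, Suc i}})"

lemma nontwins_subset: "nontwins (N, \<chi>) \<subseteq> {1..<N}"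
  by (auto simp: nontwins_def)

text \<open>Moving from \<open>i\<close> to \<open>i'\<close> one step at a time passes only twins
  and never meets \<open>x\<close>.\<close>

lemma twins_interval:
  assumes "i \<le> i'" "1 \<le> i" "i' \<le> N" "x \<in> {1..N}" "x < i \<or> i' < x"
    and "nontwins (N, \<chi>) \<inter> {i..<i'} = {}"
  shows "\<chi> {x, i} = \<chi> {x, i'}"
  using assms
proof (induction i' rule: dec_induct)
  case (step j)
  have "nontwins (N, \<chi>) \<inter> {i..<j} = {}"
    using step.prems(5) by fastforce
  then have "\<chi> {x, i} = \<chi> {x, j}"
    using step by auto
  also have "\<chi> {x, j} = \<chi> {x, Suc j}"
  proof -
    have "j \<notin> nontwins (N, \<chi>)" "x \<notin> {j, Suc j}" "j \<in> {1..<N}"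
      using step by auto
    then show ?thesis
      using step.prems by (auto simp: nontwins_def)
  qed
  finally show ?case .
qed simp

text \<open>The set \<open>D\<close> cuts \<open>{1..n}\<close> into intervals, and the interval of \<open>i\<close> has number \<open>block D i\<close>.\<close>

definition block :: "nat set \<Rightarrow> nat \<Rightarrow> nat" where
  "block D i = card {d \<in> D. d < i}"

lemma block_eqD:
  assumes "finite D" "block D i = block D i'" "i \<le> i'"
  shows "D \<inter> {i..<i'} = {}"
proof -
  have "{d \<in> D. d < i} = {d \<in> D. d < i'}"
    using assms by (intro card_subset_eq) (auto simp: block_def)
  then have "d < i" if "d \<in> D" "d < i'" for d
    using that by blast
  then show ?thesis
    by fastforce
qed

text \<open>Both pairs are stretched to the leftmost left end and the rightmost right end. Each end
  moves away from the other, which therefore stays outside the interval passed.\<close>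

lemma color_determined_by_blocks:
  assumes D: "finite D" "nontwins (N, \<chi>) \<subseteq> D"
    and ij: "1 \<le> i" "i < j" "j \<le> N" and ij': "1 \<le> i'" "i' < j'" "j' \<le> N"
    and eq: "block D i = block D i'" "block D j = block D j'"
  shows "\<chi> {i, j} = \<chi> {i', j'}"
proof -
  define a where "a = min i i'"
  define b where "b = max j j'"
  have "\<chi> {k, l} = \<chi> {a, b}"
    if "1 \<le> k" "k < l" "l \<le> N" "block D a = block D k" "block D l = block D b" "a \<le> k" "l \<le> b" for k l
  proof -
    have "nontwins (N, \<chi>) \<inter> {a..<k} = {}" "nontwins (N, \<chi>) \<inter> {l..<b} = {}"
      using block_eqD[OF D(1)] that D(2) by blast+
    moreover have "1 \<le> a" "b \<le> N"
      using ij ij' by (auto simp: a_def b_def)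
    ultimately have "\<chi> {l, a} = \<chi> {l, k}" "\<chi> {a, l} = \<chi> {a, b}"
      using that twins_interval[of a k N l \<chi>] twins_interval[of l b N a \<chi>] by auto
    then show ?thesis
      by (simp add: insert_commute)
  qed
  from this[of i j] this[of i' j'] show ?thesis
    using ij ij' eq by (auto simp: a_def b_def min_def max_def)
qed

text \<open>The cut set is padded with points beyond \<open>n\<close> to have exactly \<open>k\<close> elements, and the colors of
  pairs of intervals that contain no pair of points are filled with \<open>undefined\<close>.\<close>

lemma card_level_le_few_nontwins:
  assumes "finite P" "X \<subseteq> colorings P" and few: "\<And>K. K \<in> X \<Longrightarrow> card (nontwins K) \<le> k"
  shows "card (level X n) \<le> (n + k) ^ k * (card P + 1) ^ ((k + 1) * (k + 1))"
proof -
  \<comment> \<open>A set of \<open>k\<close> cut points gives block numbers from 0 to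
    \<open>k\<close>.\<close>
  define M where "M = {..k} \<times> {..k} \<rightarrow>\<^sub>E insert undefined P"
  define decode :: "nat set \<times> (nat \<times> nat \<Rightarrow> 'a) \<Rightarrow> 'a coloring" where
    "decode = (\<lambda>(D, m). (n, \<lambda>e\<in>nsets {1..n} 2. m (block D (Min e), block D (Max e))))"
  have fin: "finite (nsets {1..n + k} k)" "finite M"
    using assms(1) by (auto simp: M_def intro: finite_imp_finite_nsets finite_PiE)
  have "level X n \<subseteq> decode ` (nsets {1..n + k} k \<times> M)"
  proof
    fix K assume "K \<in> level X n"
    then obtain \<chi> where K: "K = (n, \<chi>)" and X: "(n, \<chi>) \<in> X"
      by (cases K) (auto simp: level_def)
    have \<chi>: "\<chi> \<in> nsets {1..n} 2 \<rightarrow>\<^sub>E P"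
      using X assms(2) by (auto simp: colorings_def)
    have "nontwins (n, \<chi>) \<subseteq> {1..n + k}"
      using nontwins_subset[of n \<chi>] by auto
    then obtain D where D: "nontwins (n, \<chi>) \<subseteq> D" "D \<subseteq> {1..n + k}" "card D = k"
      using exists_subset_between[of "nontwins (n, \<chi>)" k "{1..n + k}"] few[OF X] by auto
    have finD: "finite D"
      using D(2) finite_subset by blast
    have block_le: "block D i \<le> k" for i
      unfolding block_def using card_mono[OF finD, of "{d \<in> D. d < i}"] D(3) by auto
    \<comment> \<open>The matrix entry is the color of an arbitrary pair from the two blocks; by
      \<open>color_determined_by_blocks\<close> the choice does not matter.\<close>
    define Q where "Q s t e \<longleftrightarrow> (\<exists>i j. e = {i, j} \<and> 1 \<le> i \<and> i < j \<and> j \<le> n \<and> block D i = s \<and> block D j = t)"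
      for s t e
    define m where "m = (\<lambda>(s, t)\<in>{..k} \<times> {..k}. if \<exists>e. Q s t e then \<chi> (SOME e. Q s t e) else undefined)"
    have Q_nsets: "e \<in> nsets {1..n} 2" if "Q s t e" for s t e
      using that by (auto simp: Q_def)
    have val: "(if \<exists>e. Q s t e then \<chi> (SOME e. Q s t e) else undefined) \<in> insert undefined P" for s t
      using PiE_mem[OF \<chi> Q_nsets[OF someI_ex[of "Q s t"]]] by simp
    have "m \<in> M"
      unfolding M_def m_def restrict_PiE_iff case_prod_beta by (intro ballI val)
    moreover have "m (block D (Min e), block D (Max e)) = \<chi> e" if e: "e \<in> nsets {1..n} 2" for e
    proof -
      obtain i j where ij: "e = {i, j}" "1 \<le> i" "i < j" "j \<le> n"
        using e by (auto simp: ordered_nsets_2_eq)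
      let ?Q = "Q (block D i) (block D j)"
      have "?Q e"
        using ij by (auto simp: Q_def)
      define e' where "e' = (SOME e. ?Q e)"
      have "?Q e'"
        unfolding e'_def using \<open>?Q e\<close> by (rule someI)
      then obtain i' j' where "e' = {i', j'}" "1 \<le> i'" "i' < j'" "j' \<le> n"
          "block D i' = block D i" "block D j' = block D j"
        unfolding Q_def by blast
      then have "\<chi> e' = \<chi> e"
        using color_determined_by_blocks[OF finD D(1), of i' j' i j] ij by simp
      moreover have "m (block D i, block D j) = \<chi> e'"
      proof -
        have "\<exists>e. ?Q e"
          using \<open>?Q e\<close> by blast
        then show ?thesis
          using block_le by (simp add: m_def e'_def)
      qed
      moreover have "Min e = i" "Max e = j"
        using ij by auto
      ultimately show ?thesis
        by simp
    qed
    then have "(\<lambda>e\<in>nsets {1..n} 2. m (block D (Min e), block D (Max e))) = \<chi>"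
      using \<chi> by (intro extensionalityI[of _ "nsets {1..n} 2"]) (simp_all add: PiE_iff)
    then have "decode (D, m) = K"
      by (simp add: decode_def K)
    moreover have "D \<in> nsets {1..n + k} k"
      using D finD by (simp add: nsets_def)
    ultimately show "K \<in> decode ` (nsets {1..n + k} k \<times> M)"
      by (intro image_eqI[of _ _ "(D, m)"]) auto
  qed
  then have "card (level X n) \<le> card (nsets {1..n + k} k \<times> M)"
    using fin by (intro surj_card_le) auto
  also have "\<dots> = ((n + k) choose k) * card (insert undefined P) ^ ((k + 1) * (k + 1))"
    by (simp add: card_cartesian_product M_def card_PiE card_nsets)
  also have "\<dots> \<le> (n + k) ^ k * (card P + 1) ^ ((k + 1) * (k + 1))"
    using binomial_le_pow[of k "n + k"] assms(1)
    by (intro mult_mono power_mono) (auto simp: card_insert_if)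
  finally show ?thesis .
qed

text \<open>At \<open>n = 1\<close> the bound \<open>n powr c\<close> is 1 for every
  \<open>c\<close>, so this level is treated separately.\<close>

lemma level_one_card:
  assumes "X \<subseteq> colorings P"
  shows "card (level X 1) \<le> 1"
proof -
  have "nsets {1..1::nat} 2 = {}"
    by (simp add: nsets_eq_empty)
  then have "level X 1 \<subseteq> {(1, \<lambda>_. undefined)}"
    using assms by (auto simp: level_def colorings_def)
  then show ?thesis
    using card_mono[of "{(1::nat, \<lambda>_. undefined)}"] by simp
qed

text \<open>For \<open>n \<ge> 2\<close> every constant \<open>l\<close> is below
  \<open>n ^ l\<close>, so constant factors can be moved into the exponent.\<close>

lemma polynomial_bound:
  assumes "finite P" "X \<subseteq> colorings P" "\<And>K. K \<in> X \<Longrightarrow> card (nontwins K) \<le> k"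
  shows "\<exists>c::real. c > 0 \<and> (\<forall>n::nat. n \<ge> 1 \<longrightarrow> real (card (level X n)) \<le> real n powr c)"
proof -
  define e where "e = (k + 1) * k + (card P + 1) * ((k + 1) * (k + 1))"
  have "real (card (level X n)) \<le> real n powr (e + 1)" if "n \<ge> 1" for n
  proof (cases "n = 1")
    case True
    then show ?thesis
      using level_one_card[OF assms(2)] by simp
  next
    case False
    then have n: "n \<ge> 2"
      using that by simp
    have pow: "l < n ^ l" for l
      using less_exp[of l] power_mono[OF n, of l] by linarith
    have "n + k \<le> n * Suc k"
      using n by (simp add: algebra_simps)
    also have "\<dots> \<le> n * n ^ k"
      using pow[of k] by (intro mult_mono) auto
    finally have "n + k \<le> n ^ (k + 1)"
      by simp
    moreover have "card P + 1 \<le> n ^ (card P + 1)"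
      using pow[of "card P + 1"] by simp
    ultimately have "(n + k) ^ k * (card P + 1) ^ ((k + 1) * (k + 1))
        \<le> (n ^ (k + 1)) ^ k * (n ^ (card P + 1)) ^ ((k + 1) * (k + 1))"
      by (intro mult_mono power_mono) auto
    also have "\<dots> = n ^ e"
      by (simp only: e_def power_add power_mult)
    also have "\<dots> \<le> n ^ (e + 1)"
      using n by (intro power_increasing) auto
    finally have "card (level X n) \<le> n ^ (e + 1)"
      using card_level_le_few_nontwins[OF assms, of n] by linarith
    then have "real (card (level X n)) \<le> real n ^ (e + 1)"
      by (metis of_nat_le_iff of_nat_power)
    also have "\<dots> = real n powr (e + 1)"
      using n by (subst powr_realpow) auto
    finally show ?thesis .
  qed
  then show ?thesis
    by (intro exI[of _ "real (e + 1)"]) auto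
qed

subsection \<open>The dichotomy\<close>

lemma fib_le_card_level_many_nontwins:
  assumes "finite P" "X \<subseteq> colorings P" "hereditary X" and n: "1 \<le> n"
    and many: "\<And>k. \<exists>K\<in>X. k < card (nontwins K)"
  shows "shifted_fib n \<le> card (level X n)"
proof -
  have "finite (insert undefined P)"
    using assms(1) by simp
  \<comment> \<open>Indices 1 to \<open>n\<close> carry the structures; 0 and \<open>n + 2\<close>
    serve as fixed points to the left and right of this index range.\<close>
  from ramsey_profile[OF this, of "n + 3"] obtain q where
    q: "\<forall>\<chi> (pt :: vertex \<Rightarrow> nat \<Rightarrow> nat). range \<chi> \<subseteq> insert undefined P \<longrightarrow>
      (\<exists>h c. h \<in> {..<n + 3} \<rightarrow> {..<q} \<and> strict_mono_on {..<n + 3} h \<and>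
        (\<forall>k l. k < l \<and> l < n + 3 \<longrightarrow> profile \<chi> pt (h k) (h l) = c))"
    by (elim exE)
  obtain N \<chi> where X: "(N, \<chi>) \<in> X" and card: "q < card (nontwins (N, \<chi>))"
    using many[of q] by auto
  have "\<chi> \<in> nsets {1..N} 2 \<rightarrow>\<^sub>E P"
    using X assms(2) by (auto simp: colorings_def)
  then have range_\<chi>: "range \<chi> \<subseteq> insert undefined P"
    using PiE_arb by fastforce
  have "finite (nontwins (N, \<chi>))"
    using nontwins_subset finite_subset by blast
  then obtain a where a: "bij_betw a {..<card (nontwins (N, \<chi>))} (nontwins (N, \<chi>))"
      "strict_mono_on {..<card (nontwins (N, \<chi>))} a"
    using ex_bij_betw_strict_mono_card by blast
  have "a k \<in> {1..<N} \<and> (\<exists>x\<in>{1..N} - {a k, Suc (a k)}. \<chi> {x, a k} \<noteq> \<chi> {x, Suc (a k)})"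
    if "k < q" for k
  proof -
    have "a k \<in> nontwins (N, \<chi>)"
      using bij_betwE[OF a(1)] that card by simp
    then show ?thesis
      by (simp add: nontwins_def)
  qed
  then have "\<exists>x. k < q \<longrightarrow> a k \<in> {1..<N} \<and> x \<in> {1..N} - {a k, Suc (a k)} \<and> \<chi> {x, a k} \<noteq> \<chi> {x, Suc (a k)}" for k
    by blast
  then obtain w where w: "\<forall>k. k < q \<longrightarrow> a k \<in> {1..<N} \<and> w k \<in> {1..N} - {a k, Suc (a k)} \<and>
      \<chi> {w k, a k} \<noteq> \<chi> {w k, Suc (a k)}"
    by (rule exE[OF choice[OF allI]])
  define pt where "pt s k = (case s of A \<Rightarrow> a k | B \<Rightarrow> Suc (a k) | W \<Rightarrow> w k)" for s k
  from q[rule_format, OF range_\<chi>, of pt] obtain h c where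
    "h \<in> {..<n + 3} \<rightarrow> {..<q} \<and> strict_mono_on {..<n + 3} h \<and>
      (\<forall>k l. k < l \<and> l < n + 3 \<longrightarrow> profile \<chi> pt (h k) (h l) = c)"
    by (elim exE)
  then have h: "h \<in> {..<n + 3} \<rightarrow> {..<q}" "strict_mono_on {..<n + 3} h"
    and hom: "\<And>k l. k < l \<Longrightarrow> l < n + 3 \<Longrightarrow> profile \<chi> pt (h k) (h l) = c"
    by simp_all
  have h_less: "h k < q" if "k < n + 3" for k
    using h(1) that by auto
  show ?thesis
  proof (rule card_level_ge_fib_homogeneous[OF assms(3) finite_level[OF assms(1,2)] X n,
        of "\<lambda>s k. pt s (h k)" c])
    show "pt s (h k) \<in> {1..N}" if "k < n + 3" for s k
      using w[rule_format, OF h_less[OF that]] by (cases s) (auto simp: pt_def)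
    show "profile \<chi> (\<lambda>s k. pt s (h k)) k l = c" if "k < l" "l < n + 3" for k l
      using hom[OF that] by (simp add: profile_def)
    show "pt A (h k) < pt A (h l)" if "k < l" "l < n + 3" for k l
    proof -
      have "h k < h l"
        using strict_mono_onD[OF h(2)] that by simp
      then show ?thesis
        using strict_mono_onD[OF a(2), of "h k" "h l"] h_less[of k] h_less[of l] that card
        by (simp add: pt_def)
    qed
    show "pt W (h k) \<noteq> pt A (h k) \<and> pt W (h k) \<noteq> pt B (h k) \<and>
        \<chi> {pt A (h k), pt W (h k)} \<noteq> \<chi> {pt B (h k), pt W (h k)}" if "k < n + 3" for k
      using w[rule_format, OF h_less[OF that]] by (simp add: pt_def insert_commute)
  qed (simp add: pt_def)
qed

theorem theorem3p8:
  fixes P :: "'p set" and r :: "'p rel" and X :: "'p coloring set"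
  assumes "finite P"
    and "partial_order_on P r"
    and "coloring_ideal P r X"
  shows "(\<exists>c::real. c > 0 \<and> (\<forall>n::nat. n \<ge> 1 \<longrightarrow> real (card (level X n)) \<le> real n powr c)) \<or>
         (\<forall>n::nat. n \<ge> 1 \<longrightarrow> card (level X n) \<ge> shifted_fib n)"
proof (cases "\<exists>k. \<forall>K\<in>X. card (nontwins K) \<le> k")
  case True
  then show ?thesis
    using polynomial_bound[OF assms(1)] assms(3) unfolding coloring_ideal_def by blast
next
  case False
  then have "\<exists>K\<in>X. k < card (nontwins K)" for k
    by (meson not_le)
  then show ?thesis
    using fib_le_card_level_many_nontwins[OF assms(1) _ coloring_ideal_hereditary[OF assms(2,3)]]
      assms(3) unfolding coloring_ideal_def by blast
qed

end
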